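(* Let $\alpha,\beta,r$ be complex numbers with $\beta\neq0$, and let $n,s\in\{0,1,2,\ldots\}$. For $|x|<1$, $$\sum_{k=0}^{\infty}\binom{s+k}{k}(r+k\beta\mid\alpha)_{n}\,x^{k}=\frac{1}{(1-x)^{s+1}}\,w_{n}^{(s+1)}\left(\frac{x}{1-x};\alpha,\beta,r\right).$$
   Context: The generalized factorial with increment $\alpha$ is $(z\mid\alpha)_0=1$, $(z\mid\alpha)_n=z(z-\alpha)\cdots(z-n\alpha+\alpha)$. The generalized Stirling numbers $S(n,k;\alpha,\beta,r)$ are characterised by: for every $n$-times differentiable $f$ on $(0,\infty)$, with $D=d/dx$, $$\left(\beta x^{1-\alpha/\beta}D\right)^{n}\left[x^{r/\beta}f(x)\right]=x^{(r-n\alpha)/\beta}\sum_{k=0}^{n}S(n,k;\alpha,\beta,r)\beta^{k}x^{k}f^{(k)}(x);$$ equivalently, by the formal power series identity $$\left(\frac{(1+\alpha t)^{\beta/\alpha}-1}{\beta}\right)^{k}(1+\alpha t)^{r/\alpha}=k!\sum_{n=0}^{\infty}S(n,k;\alpha,\beta,r)\frac{t^{n}}{n!},$$ where $(1+\alpha t)^{c/\alpha}$ is interpreted as $e^{ct}$ when $\alpha=0$. The higher order generalized geometric polynomials are $$w_{n}^{(s+1)}(x;\alpha,\beta,r)=\sum_{k=0}^{n}S(n,k;\alpha,\beta,r)\binom{s+k}{k}k!\,\beta^{k}x^{k}.$$ *)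

theory Defs
  imports Complex_Main "HOL-Computational_Algebra.Formal_Power_Series"
begin

definition gen_fact :: "complex \<Rightarrow> complex \<Rightarrow> nat \<Rightarrow> complex" where
  "gen_fact z \<alpha> n = (\<Prod>i<n. z - of_nat i * \<alpha>)"

text \<open>The formal power series \<open>(1 + \<alpha> t)\<^bsup>c/\<alpha>\<^esup>\<close>, read as \<open>e\<^bsup>c t\<^esup>\<close> for \<open>\<alpha> = 0\<close>.\<close>

definition gen_pow_fps :: "complex \<Rightarrow> complex \<Rightarrow> complex fps" where
  "gen_pow_fps \<alpha> c =
     (if \<alpha> = 0 then fps_exp c
      else fps_compose (fps_binomial (c / \<alpha>)) (fps_const \<alpha> * fps_X))"

text \<open>The numbers \<open>S(n,k;\<alpha>,\<beta>,r)\<close> are read off from their exponential generating function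
  in \<open>n\<close>; see \<open>gen_stirling_generating_function\<close>. Only meaningful for \<open>\<beta> \<noteq> 0\<close>.\<close>

definition gen_stirling :: "nat \<Rightarrow> nat \<Rightarrow> complex \<Rightarrow> complex \<Rightarrow> complex \<Rightarrow> complex" where
  "gen_stirling n k \<alpha> \<beta> r =
     fact n / fact k *
     fps_nth (((gen_pow_fps \<alpha> \<beta> - 1) / fps_const \<beta>) ^ k * gen_pow_fps \<alpha> r) n"

lemma gen_stirling_generating_function:
  "((gen_pow_fps \<alpha> \<beta> - 1) / fps_const \<beta>) ^ k * gen_pow_fps \<alpha> r =
     fps_const (fact k) * Abs_fps (\<lambda>n. gen_stirling n k \<alpha> \<beta> r / fact n)"
  by (rule fps_ext) (simp add: gen_stirling_def)

text \<open>The polynomial \<open>w\<^sub>n\<^bsup>(s+1)\<^esup>(x;\<alpha>,\<beta>,r)\<close>: note that its order is \<open>s + 1\<close>, not \<open>s\<close>.\<close>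

definition gen_geom_poly ::
  "nat \<Rightarrow> nat \<Rightarrow> complex \<Rightarrow> complex \<Rightarrow> complex \<Rightarrow> complex \<Rightarrow> complex" where
  "gen_geom_poly n s x \<alpha> \<beta> r =
     (\<Sum>k=0..n. gen_stirling n k \<alpha> \<beta> r * of_nat ((s + k) choose k) * fact k * \<beta> ^ k * x ^ k)"

end

(*
Write g(c) for the series (1 + \<alpha> t)^(c/\<alpha>), so that (c | \<alpha>)_n = n! [t^n] g(c) and
g(a + b) = g(a) g(b).  Expanding g(\<beta>)^k = (1 + u)^k with u = g(\<beta>) - 1 of positive order gives
(r + k \<beta> | \<alpha>)_n = sum over j \<le> n of binomial(k, j) S(n, j) j! \<beta>^j.  The claim then
follows by summing binomial(s + k, k) binomial(k, j) x^k over k, a shifted negative binomial series.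
*)
theory Submission
  imports Defs "HOL-Analysis.Generalised_Binomial_Theorem"
begin

text \<open>Composing with \<open>fps_const \<alpha> * fps_X\<close> scales the n-th coefficient by
  \<open>\<alpha> ^ n\<close>; spread over the n factors of the binomial numerator, this turns each
  \<open>c / \<alpha> - i\<close> into \<open>c - i * \<alpha>\<close>. For
  \<open>\<alpha> = 0\<close> both sides are \<open>c ^ n / fact n\<close>.\<close>

lemma gen_pow_fps_nth: "fps_nth (gen_pow_fps \<alpha> c) n = gen_fact c \<alpha> n / fact n"
proof (cases "\<alpha> = 0")
  case True
  then show ?thesis by (simp add: gen_pow_fps_def gen_fact_def)
next
  case False
  have "\<alpha> ^ n * ((c / \<alpha>) gchoose n) = (\<Prod>i<n. \<alpha> * (c / \<alpha> - of_nat i)) / fact n"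
    by (simp add: gbinomial_prod_rev prod.distrib atLeast0LessThan)
  also have "(\<Prod>i<n. \<alpha> * (c / \<alpha> - of_nat i)) = gen_fact c \<alpha> n"
    unfolding gen_fact_def by (rule prod.cong) (use False in \<open>simp_all add: field_simps\<close>)
  finally show ?thesis
    using False by (simp add: gen_pow_fps_def fps_compose_linear)
qed

lemma gen_pow_fps_add: "gen_pow_fps \<alpha> (a + b) = gen_pow_fps \<alpha> a * gen_pow_fps \<alpha> b"
proof (cases "\<alpha> = 0")
  case True
  then show ?thesis by (simp add: gen_pow_fps_def fps_exp_add_mult)
next
  case False
  then show ?thesis
    by (simp add: gen_pow_fps_def add_divide_distrib fps_binomial_add_mult
        fps_compose_mult_distrib)
qed

lemma gen_pow_fps_0: "gen_pow_fps \<alpha> 0 = 1"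
  by (simp add: gen_pow_fps_def)

lemma gen_pow_fps_of_nat_mult: "gen_pow_fps \<alpha> (of_nat k * c) = gen_pow_fps \<alpha> c ^ k"
  by (induction k) (simp_all add: gen_pow_fps_0 gen_pow_fps_add distrib_right)

text \<open>The weight \<open>fact k * \<beta> ^ k\<close> from \<open>gen_geom_poly\<close> cancels
  exactly the denominators in \<open>gen_stirling\<close>.\<close>

lemma gen_stirling_power:
  assumes "\<beta> \<noteq> 0"
  shows "gen_stirling n k \<alpha> \<beta> r * fact k * \<beta> ^ k =
    fact n * fps_nth ((gen_pow_fps \<alpha> \<beta> - 1) ^ k * gen_pow_fps \<alpha> r) n"
proof -
  define u where "u = (gen_pow_fps \<alpha> \<beta> - 1) / fps_const \<beta>"
  have "gen_pow_fps \<alpha> \<beta> - 1 = fps_const \<beta> * u"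
    unfolding u_def using assms by (simp add: fps_divide_unit mult.left_commute fps_const_inverse)
  then have "(gen_pow_fps \<alpha> \<beta> - 1) ^ k = fps_const (\<beta> ^ k) * u ^ k"
    by (simp add: power_mult_distrib fps_const_power)
  then show ?thesis
    by (simp add: gen_stirling_def u_def mult.assoc)
qed

lemma gen_fact_eq_sum_gen_stirling:
  assumes "\<beta> \<noteq> 0"
  shows "gen_fact (r + of_nat k * \<beta>) \<alpha> n =
    (\<Sum>j=0..n. of_nat (k choose j) * (gen_stirling n j \<alpha> \<beta> r * fact j * \<beta> ^ j))"
proof -
  define u where "u = gen_pow_fps \<alpha> \<beta> - 1"
  define a where "a j = fact n * fps_nth (u ^ j * gen_pow_fps \<alpha> r) n" for j
  have u0: "fps_nth u 0 = 0"
    by (simp add: u_def gen_pow_fps_nth gen_fact_def)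
  \<comment> \<open>\<open>u ^ j\<close> has no terms below degree j, so for \<open>n < j\<close> it
    cannot contribute to the n-th coefficient of a product.\<close>
  have a0: "a j = 0" if "n < j" for j
    using that startsby_zero_power_prefix[OF u0, of j]
    by (simp add: a_def fps_mult_nth)
  have "gen_pow_fps \<alpha> (r + of_nat k * \<beta>) = (u + 1) ^ k * gen_pow_fps \<alpha> r"
    unfolding gen_pow_fps_add gen_pow_fps_of_nat_mult by (simp add: u_def mult.commute)
  also have "\<dots> = (\<Sum>j\<le>k. fps_const (of_nat (k choose j)) * (u ^ j * gen_pow_fps \<alpha> r))"
    by (simp add: binomial_ring sum_distrib_right fps_of_nat mult.assoc)
  finally have "fps_nth (gen_pow_fps \<alpha> (r + of_nat k * \<beta>)) n =
      (\<Sum>j\<le>k. of_nat (k choose j) * fps_nth (u ^ j * gen_pow_fps \<alpha> r) n)"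
    by (simp add: fps_sum_nth)
  then have "gen_fact (r + of_nat k * \<beta>) \<alpha> n = (\<Sum>j\<le>k. of_nat (k choose j) * a j)"
    by (simp add: gen_pow_fps_nth a_def sum_distrib_left field_simps)
  \<comment> \<open>The bound k is traded for n through their maximum: the binomial coefficient
    vanishes for \<open>j > k\<close>, and \<open>a j\<close> vanishes for
    \<open>j > n\<close>.\<close>
  also have "\<dots> = (\<Sum>j\<le>max k n. of_nat (k choose j) * a j)"
    by (rule sum.mono_neutral_left) auto
  also have "\<dots> = (\<Sum>j=0..n. of_nat (k choose j) * a j)"
    by (rule sum.mono_neutral_right) (auto simp: a0)
  finally show ?thesis
    by (simp add: a_def u_def gen_stirling_power[OF assms])
qed

lemma negative_binomial_sums:
  fixes x :: complex
  assumes "norm x < 1"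
  shows "(\<lambda>i. of_nat ((m + i) choose i) * x ^ i) sums (1 / (1 - x) ^ (m + 1))"
proof -
  have ne: "1 - x \<noteq> 0" using assms by auto
  have "(\<lambda>i. (- of_nat (m + 1) gchoose i) * (- x) ^ i) sums (1 + - x) powr (- of_nat (m + 1))"
    by (rule gen_binomial_complex) (use assms in simp)
  moreover have "(- of_nat (m + 1) gchoose i) * (- x) ^ i = of_nat ((m + i) choose i) * x ^ i" for i
  proof -
    \<comment> \<open>Upper negation: the new upper index is
      \<open>(m + 1) + i - 1 = m + i\<close>.\<close>
    have "(- of_nat (m + 1) gchoose i) = (- 1) ^ i * (of_nat (m + i) gchoose i :: complex)"
      by (subst gbinomial_minus) (simp add: algebra_simps)
    moreover have "(- 1) ^ i * (- x) ^ i = x ^ i"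
      by (simp flip: power_mult_distrib)
    ultimately show ?thesis
      by (simp add: binomial_gbinomial mult.commute mult.left_commute)
  qed
  moreover have "(1 + - x) powr (- of_nat (m + 1)) = 1 / (1 - x) ^ (m + 1)"
    using ne powr_nat'[of "1 - x" "m + 1"] by (simp only: powr_minus) (simp add: field_simps)
  ultimately show ?thesis by simp
qed

text \<open>Both products equal the multinomial coefficient
  \<open>(s + i + j)! / (s! i! j!)\<close>.\<close>

lemma choose_mult_choose_shift:
  "((s + (i + j)) choose (i + j)) * ((i + j) choose j) =
    ((s + j) choose j) * ((s + j + i) choose i)"
  using choose_mult_lemma[of j s i] binomial_symmetric[of j "i + j"] by (simp add: ac_simps)

text \<open>Terms with \<open>k < j\<close> vanish, so put \<open>k = i + j\<close>. The multinomial
  identity then pulls out a factor free of i and leaves the negative binomial series with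
  \<open>m = s + j\<close>.\<close>

lemma choose_mult_choose_sums:
  fixes x :: complex
  assumes "norm x < 1"
  shows "(\<lambda>k. of_nat ((s + k) choose k) * of_nat (k choose j) * x ^ k)
    sums (of_nat ((s + j) choose j) * x ^ j / (1 - x) ^ (s + j + 1))" (is "?f sums ?S")
proof -
  have "(\<lambda>i. of_nat ((s + j) choose j) * x ^ j * (of_nat ((s + j + i) choose i) * x ^ i)) sums
      (of_nat ((s + j) choose j) * x ^ j * (1 / (1 - x) ^ (s + j + 1)))"
    by (intro sums_mult negative_binomial_sums assms)
  moreover have "of_nat ((s + j) choose j) * x ^ j * (of_nat ((s + j + i) choose i) * x ^ i) =
      ?f (i + j)" for i
    using choose_mult_choose_shift[of s i j, THEN arg_cong, of "of_nat :: nat \<Rightarrow> complex"]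
    by (simp add: power_add)
  ultimately have "(\<lambda>i. ?f (i + j)) sums ?S" by simp
  then show ?thesis
    by (subst (asm) sums_zero_iff_shift) auto
qed

theorem mainTheorem13:
  fixes \<alpha> \<beta> r x :: complex and n s :: nat
  assumes "\<beta> \<noteq> 0" and "norm x < 1"
  shows "(\<lambda>k. of_nat ((s + k) choose k) * gen_fact (r + of_nat k * \<beta>) \<alpha> n * x ^ k)
           sums (1 / (1 - x) ^ (s + 1) * gen_geom_poly n s (x / (1 - x)) \<alpha> \<beta> r)"
proof -
  define c where "c j = gen_stirling n j \<alpha> \<beta> r * fact j * \<beta> ^ j" for j
  \<comment> \<open>The range of j does not depend on k, so exchanging the two summations is only
    finite linearity of \<open>sums\<close>.\<close>
  have "(\<lambda>k. \<Sum>j=0..n. c j * (of_nat ((s + k) choose k) * of_nat (k choose j) * x ^ k)) sums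
      (\<Sum>j=0..n. c j * (of_nat ((s + j) choose j) * x ^ j / (1 - x) ^ (s + j + 1)))"
    by (intro sums_sum sums_mult choose_mult_choose_sums assms)
  moreover have "(\<Sum>j=0..n. c j * (of_nat ((s + k) choose k) * of_nat (k choose j) * x ^ k)) =
      of_nat ((s + k) choose k) * gen_fact (r + of_nat k * \<beta>) \<alpha> n * x ^ k" for k
    unfolding gen_fact_eq_sum_gen_stirling[OF assms(1)] c_def sum_distrib_left sum_distrib_right
    by (simp only: mult_ac)
  \<comment> \<open>Of the \<open>s + j + 1\<close> factors \<open>1 - x\<close>, j combine with
    \<open>x ^ j\<close> into the power of \<open>x / (1 - x)\<close>; the other
    \<open>s + 1\<close> form the prefactor.\<close>
  moreover have "(\<Sum>j=0..n. c j * (of_nat ((s + j) choose j) * x ^ j / (1 - x) ^ (s + j + 1))) =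
      1 / (1 - x) ^ (s + 1) * gen_geom_poly n s (x / (1 - x)) \<alpha> \<beta> r"
    by (simp add: gen_geom_poly_def c_def sum_distrib_left power_divide power_add mult_ac)
  ultimately show ?thesis by simp
qed

end
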